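(* There is an absolute constant $K>0$ such that for all integers $m,n\ge 2$ the following holds. In the random access model, every Preference Elicitation algorithm for the class of all profiles of $n$ voters over $m$ candidates that are single crossing with respect to the identity permutation of the voters has query complexity at least $K\,(m\log m+m\log n)$; that is, the query complexity is $\Omega(m\log m+m\log n)$.
   Context: Let $\mathcal{C}$ be a set of $m$ candidates and $[n]=\{1,\dots,n\}$ the set of voters. A preference is a strict total order on $\mathcal{C}$; a profile is an $n$-tuple $\mathcal{P}=(\succ_1,\dots,\succ_n)$ of preferences. For a permutation $\sigma$ of $[n]$, $\mathcal{P}$ is single crossing with respect to $\sigma$ if for every two distinct $x,y\in\mathcal{C}$, whenever $x\succ_{\sigma(i)}y$ and $x\succ_{\sigma(j)}y$ with $1\le i<j\le n$, then $x\succ_{\sigma(k)}y$ for every $i\le k\le j$. The oracle $\mathrm{Query}(x\succ_\ell y)$ ($\ell$ a voter, $x\ne y$ candidates) returns true if voter $\ell$ prefers $x$ to $y$, and false otherwise. A Preference Elicitation algorithm for a class of profiles is a deterministic adaptive procedure that, for every unknown profile $\mathcal{P}$ in the class, outputs $\mathcal{P}$ exactly using only oracle calls. Its query complexity is the maximum, over profiles in the class, of the number of pairs (voter $\ell$, unordered pair $\{x,y\}$ of distinct candidates) for which the algorithm compares $x$ and $y$ for voter $\ell$ (repeated calls are counted once). In the random access model any voter may be queried at any time, and queries to different voters may be interleaved. Logarithms are base 2. *)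

theory Defs
  imports Complex_Main "HOL-Library.FuncSet" "HOL-Combinatorics.Permutations"
begin

text \<open>\<open>(x, y) \<in> r\<close> means that \<open>x\<close> is strictly preferred to \<open>y\<close>.\<close>

definition preferences :: "'c set \<Rightarrow> ('c \<times> 'c) set set" where
  "preferences C = {r. r \<subseteq> C \<times> C \<and> strict_linear_order_on C r}"

type_synonym 'c profile = "nat \<Rightarrow> ('c \<times> 'c) set"

text \<open>The extensional function space makes equality of two profiles mean equality of the
  \<open>n\<close>-tuples of preferences.\<close>

definition profiles :: "'c set \<Rightarrow> nat \<Rightarrow> 'c profile set" where
  "profiles C n = {1..n} \<rightarrow>\<^sub>E preferences C"

definition single_crossing :: "'c set \<Rightarrow> nat \<Rightarrow> (nat \<Rightarrow> nat) \<Rightarrow> 'c profile \<Rightarrow> bool" where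
  "single_crossing C n \<sigma> P \<longleftrightarrow> \<sigma> permutes {1..n} \<and>
     (\<forall>x\<in>C. \<forall>y\<in>C. x \<noteq> y \<longrightarrow>
        (\<forall>i j. 1 \<le> i \<and> i < j \<and> j \<le> n \<and> (x, y) \<in> P (\<sigma> i) \<and> (x, y) \<in> P (\<sigma> j) \<longrightarrow>
           (\<forall>k. i \<le> k \<and> k \<le> j \<longrightarrow> (x, y) \<in> P (\<sigma> k))))"

definition single_crossing_profiles :: "'c set \<Rightarrow> nat \<Rightarrow> (nat \<Rightarrow> nat) \<Rightarrow> 'c profile set" where
  "single_crossing_profiles C n \<sigma> = {P \<in> profiles C n. single_crossing C n \<sigma> P}"

definition query :: "'c profile \<Rightarrow> nat \<Rightarrow> 'c \<Rightarrow> 'c \<Rightarrow> bool" where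
  "query P l x y \<longleftrightarrow> (x, y) \<in> P l"

text \<open>A deterministic adaptive procedure chooses its next step (a query about any voter, or
  stopping with an output) as a function of the answers received so far. The earlier queries
  need not be recorded, as they are determined by the earlier answers.\<close>

datatype 'c step = Ask nat 'c 'c | Output "'c profile"

type_synonym 'c procedure = "bool list \<Rightarrow> 'c step"

text \<open>The answers received during the first \<open>t\<close> steps on the unknown profile \<open>P\<close>, oldest first;
  the list no longer changes once the procedure has stopped.\<close>

primrec answers :: "'c procedure \<Rightarrow> 'c profile \<Rightarrow> nat \<Rightarrow> bool list" where
  "answers A P 0 = []"
| "answers A P (Suc t) = (case A (answers A P t) of
      Ask l x y \<Rightarrow> answers A P t @ [query P l x y]
    | Output Q \<Rightarrow> answers A P t)"

definition preference_elicitation ::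
  "'c set \<Rightarrow> nat \<Rightarrow> 'c profile set \<Rightarrow> 'c procedure \<Rightarrow> bool" where
  "preference_elicitation C n \<P> A \<longleftrightarrow> (\<forall>P\<in>\<P>.
     (\<forall>t l x y. A (answers A P t) = Ask l x y \<longrightarrow>
        l \<in> {1..n} \<and> x \<in> C \<and> y \<in> C \<and> x \<noteq> y) \<and>
     (\<exists>t. A (answers A P t) = Output P))"

text \<open>Being a set of voters with unordered pairs, this identifies repeated queries, as well as
  the queries \<open>Ask l x y\<close> and \<open>Ask l y x\<close>.\<close>

definition compared :: "'c procedure \<Rightarrow> 'c profile \<Rightarrow> (nat \<times> 'c set) set" where
  "compared A P = {(l, {x, y}) | l x y. \<exists>t. A (answers A P t) = Ask l x y}"

definition query_complexity :: "'c profile set \<Rightarrow> 'c procedure \<Rightarrow> nat" where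
  "query_complexity \<P> A = (MAX P\<in>\<P>. card (compared A P))"

end

theory Submission
  imports Defs
begin

text \<open>The bound is information-theoretic. An adversary who always gives the answer that keeps at
  least half of the consistent profiles forces \<open>\<lceil>log 2 N\<rceil>\<close> distinct comparisons on a class of \<open>N\<close>
  profiles; a repeated comparison costs nothing, since all consistent profiles already agree on it.
  The single crossing class contains the \<open>m!\<close> constant profiles, and also \<open>n ^ (m div 2)\<close> profiles
  in which the candidates are grouped into \<open>m div 2\<close> adjacent pairs and each pair is swapped
  once, at a voter chosen independently of the other pairs.\<close>

section \<open>The adversary argument\<close>

text \<open>A finite-time version of \<open>compared\<close>, so that the adversary argument can go
  by induction on \<open>t\<close>.\<close>

definition compared_until :: "'c procedure \<Rightarrow> 'c profile \<Rightarrow> nat \<Rightarrow> (nat \<times> 'c set) set" where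
  "compared_until A P t = {(l, {x, y}) | l x y. \<exists>s<t. A (answers A P s) = Ask l x y}"

lemma compared_until_0 [simp]: "compared_until A P 0 = {}"
  by (simp add: compared_until_def)

lemma compared_until_Suc_Ask:
  assumes "A (answers A P t) = Ask l x y"
  shows "compared_until A P (Suc t) = insert (l, {x, y}) (compared_until A P t)"
  using assms unfolding compared_until_def less_Suc_eq by auto

lemma compared_until_Suc_Output:
  assumes "A (answers A P t) = Output Q"
  shows "compared_until A P (Suc t) = compared_until A P t"
  using assms unfolding compared_until_def less_Suc_eq by auto

lemma compared_until_subset: "compared_until A P t \<subseteq> compared A P"
  by (auto simp: compared_until_def compared_def)

text \<open>Lets profiles on which the procedure stops at different times be compared at one common
  later time.\<close>

lemma answers_stop:
  assumes "A (answers A P t) = Output Q" "t \<le> u"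
  shows "answers A P u = answers A P t"
  using assms(2) by (induction rule: dec_induct) (simp_all add: assms(1))

text \<open>Comparisons are counted by unordered pairs, so one answer must settle both orders of
  asking. Totality and asymmetry of a preference give this.\<close>

lemma query_flip:
  assumes "P \<in> profiles C n" "l \<in> {1..n}" "x \<in> C" "y \<in> C" "x \<noteq> y"
  shows "query P l y x \<longleftrightarrow> \<not> query P l x y"
proof -
  have "strict_linear_order_on C (P l)"
    using assms(1,2) by (auto simp: profiles_def preferences_def)
  then have "trans (P l)" "irrefl (P l)" "total_on C (P l)"
    by (auto simp: strict_linear_order_on_def)
  then show ?thesis
    using assms(3-5) by (auto simp: query_def irrefl_def total_on_def dest: transD)
qed

lemma majority:
  assumes "finite S" "S \<noteq> {}"
  obtains b where "{P \<in> S. Q P = b} \<noteq> {}" "card S \<le> 2 * card {P \<in> S. Q P = (b::bool)}"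
proof -
  have "S = {P \<in> S. Q P = True} \<union> {P \<in> S. Q P = False}" by auto
  then have le: "card S \<le> card {P \<in> S. Q P = True} + card {P \<in> S. Q P = False}"
    by (metis card_Un_le)
  have "card S > 0" using assms by (simp add: card_gt_0_iff)
  have "card S \<le> 2 * card {P \<in> S. Q P = True} \<or> card S \<le> 2 * card {P \<in> S. Q P = False}"
    using le by linarith
  then obtain b where "card S \<le> 2 * card {P \<in> S. Q P = b}" by blast
  moreover from this have "{P \<in> S. Q P = b} \<noteq> {}"
    using \<open>card S > 0\<close> by (metis card.empty mult_0_right not_le)
  ultimately show ?thesis using that by blast
qed

text \<open>\<open>S\<close> holds the profiles still consistent with the majority answers
  \<open>bs\<close>, and \<open>D\<close> the comparisons made so far. The exponent is
  \<open>card D\<close>, not \<open>t\<close>, so a repeated comparison must not shrink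
  \<open>S\<close>; the last conjunct is carried through the induction to ensure this.\<close>

lemma adversary:
  assumes elic: "preference_elicitation C n \<P> A"
    and sub: "\<P> \<subseteq> profiles C n" and fin: "finite \<P>" and ne: "\<P> \<noteq> {}"
  shows "\<exists>S bs D. S \<subseteq> \<P> \<and> S \<noteq> {} \<and> finite D \<and> card \<P> \<le> card S * 2 ^ card D \<and>
    (\<forall>P\<in>S. answers A P t = bs \<and> compared_until A P t = D) \<and>
    (\<forall>P\<in>S. \<forall>P'\<in>S. \<forall>l x y. (l, {x, y}) \<in> D \<longrightarrow> query P l x y = query P' l x y)"
proof (induction t)
  case 0
  show ?case
    by (rule exI[of _ \<P>], rule exI[of _ "[]"], rule exI[of _ "{}"]) (use ne in simp)
next
  case (Suc t)
  then obtain S bs D where S: "S \<subseteq> \<P>" "S \<noteq> {}" "finite D" "card \<P> \<le> card S * 2 ^ card D"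
    and ans: "\<forall>P\<in>S. answers A P t = bs \<and> compared_until A P t = D"
    and agree: "\<forall>P\<in>S. \<forall>P'\<in>S. \<forall>l x y. (l, {x, y}) \<in> D \<longrightarrow> query P l x y = query P' l x y"
    by (elim exE conjE) (rule that)
  show ?case
  proof (cases "A bs")
    case (Output Q)
    have "\<forall>P\<in>S. answers A P (Suc t) = bs \<and> compared_until A P (Suc t) = D"
      using ans Output by (simp add: compared_until_Suc_Output)
    then show ?thesis
      by (intro exI[of _ S] exI[of _ bs] exI[of _ D] conjI S agree)
  next
    case (Ask l x y)
    have valid: "l \<in> {1..n}" "x \<in> C" "y \<in> C" "x \<noteq> y"
    proof -
      obtain P where P: "P \<in> S" using S(2) by blast
      then have "A (answers A P t) = Ask l x y" using ans Ask by simp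
      with P S(1) elic show "l \<in> {1..n}" "x \<in> C" "y \<in> C" "x \<noteq> y"
        unfolding preference_elicitation_def by blast+
    qed
    have flip: "query P l y x \<longleftrightarrow> \<not> query P l x y" if "P \<in> S" for P
      using query_flip[OF _ valid] that S(1) sub by blast
    have step: "compared_until A P (Suc t) = insert (l, {x, y}) D"
      "answers A P (Suc t) = bs @ [query P l x y]" if "P \<in> S" for P
      using that ans Ask by (simp_all add: compared_until_Suc_Ask)
    have "finite S" using finite_subset[OF S(1) fin] .
    then obtain b where b: "{P \<in> S. query P l x y = b} \<noteq> {}"
        "card S \<le> 2 * card {P \<in> S. query P l x y = b}"
      using S(2) by (rule majority[where Q = "\<lambda>P. query P l x y"]) (rule that)
    define S' where "S' = {P \<in> S. query P l x y = b}"
    have count: "card \<P> \<le> card S' * 2 ^ card (insert (l, {x, y}) D)"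
    proof (cases "(l, {x, y}) \<in> D")
      case True
      \<comment> \<open>All of \<open>S\<close> answers alike on a pair from \<open>D\<close>, and
        the majority side is nonempty, so nothing is discarded.\<close>
      then have "S' = S" using b(1) agree unfolding S'_def by blast
      then show ?thesis using S(4) True by (simp add: insert_absorb)
    next
      case False
      have "card \<P> \<le> card S * 2 ^ card D" by (rule S(4))
      also have "\<dots> \<le> (2 * card S') * 2 ^ card D"
        using b(2) by (intro mult_right_mono) (simp_all add: S'_def)
      finally show ?thesis using S(3) False by (simp add: mult_ac)
    qed
    have agree': "query P l' x' y' = query P' l' x' y'"
      if "P \<in> S'" "P' \<in> S'" "(l', {x', y'}) \<in> insert (l, {x, y}) D" for P P' l' x' y'
    proof (cases "(l', {x', y'}) \<in> D")
      case True
      then show ?thesis using that agree by (simp add: S'_def)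
    next
      case False
      \<comment> \<open>The new pair may be named in either order; the reversed one is settled by
        \<open>flip\<close>.\<close>
      then have "l' = l" "x' = x \<and> y' = y \<or> x' = y \<and> y' = x"
        using that(3) by (auto simp: doubleton_eq_iff)
      then show ?thesis using that(1,2) flip by (auto simp: S'_def)
    qed
    have "S' \<subseteq> \<P>" "S' \<noteq> {}" "finite (insert (l, {x, y}) D)"
      using S b(1) by (auto simp: S'_def)
    moreover have "\<forall>P\<in>S'. answers A P (Suc t) = bs @ [b] \<and>
        compared_until A P (Suc t) = insert (l, {x, y}) D"
      using step by (auto simp: S'_def)
    moreover have "\<forall>P\<in>S'. \<forall>P'\<in>S'. \<forall>l' x' y'. (l', {x', y'}) \<in> insert (l, {x, y}) D \<longrightarrow>
        query P l' x' y' = query P' l' x' y'"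
      by (intro ballI allI impI) (rule agree')
    ultimately show ?thesis
      by (intro exI[of _ S'] exI[of _ "bs @ [b]"] exI[of _ "insert (l, {x, y}) D"] conjI count)
  qed
qed

lemma finite_profiles:
  assumes "finite C"
  shows "finite (profiles C n)"
proof -
  have "preferences C \<subseteq> Pow (C \<times> C)" by (auto simp: preferences_def)
  then have "finite (preferences C)" using assms finite_subset by blast
  then show ?thesis unfolding profiles_def by (intro finite_PiE) auto
qed

lemma finite_compared:
  assumes "preference_elicitation C n \<P> A" "P \<in> \<P>" "finite C"
  shows "finite (compared A P)"
proof -
  have "compared A P \<subseteq> {1..n} \<times> Pow C"
    using assms(1,2) unfolding compared_def preference_elicitation_def by fastforce
  then show ?thesis using assms(3) finite_subset by blast
qed

lemma card_le_query_complexity: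
  assumes elic: "preference_elicitation C n \<P> A"
    and sub: "\<P> \<subseteq> profiles C n" and C: "finite C" and ne: "\<P> \<noteq> {}"
  shows "card \<P> \<le> 2 ^ query_complexity \<P> A"
proof -
  have fin: "finite \<P>" using finite_subset[OF sub] finite_profiles[OF C] by blast
  have "\<forall>P\<in>\<P>. \<exists>t. A (answers A P t) = Output P"
    using elic by (simp add: preference_elicitation_def)
  then obtain \<tau> where \<tau>: "\<And>P. P \<in> \<P> \<Longrightarrow> A (answers A P (\<tau> P)) = Output P" by metis
  \<comment> \<open>By time \<open>T\<close> the procedure has stopped on every profile of the
    class.\<close>
  define T where "T = Max (\<tau> ` \<P>)"
  have out: "A (answers A P T) = Output P" if "P \<in> \<P>" for P
  proof -
    have "\<tau> P \<le> T" using that fin by (simp add: T_def)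
    then show ?thesis using answers_stop \<tau>[OF that] by metis
  qed
  obtain S bs D where S: "S \<subseteq> \<P>" "S \<noteq> {}" "card \<P> \<le> card S * 2 ^ card D"
    and ans: "\<forall>P\<in>S. answers A P T = bs \<and> compared_until A P T = D"
    using adversary[OF elic sub fin ne, of T] by (elim exE conjE) (rule that)
  obtain P where P: "P \<in> S" using S(2) by blast
  \<comment> \<open>The members of \<open>S\<close> share the answer list \<open>bs\<close>, hence
    the output, and each is its own output.\<close>
  have "S = {P}"
  proof -
    have "P' = P" if "P' \<in> S" for P'
      using out[of P'] out[of P] ans that P S(1) by (auto simp: subset_iff)
    then show ?thesis using P by blast
  qed
  then have "card \<P> \<le> 2 ^ card D" using S(3) by simp
  also have "D \<subseteq> compared A P" using ans P compared_until_subset by metis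
  then have "card D \<le> card (compared A P)"
    using card_mono finite_compared[OF elic _ C] P S(1) by blast
  also have "card (compared A P) \<le> query_complexity \<P> A"
    unfolding query_complexity_def using fin P S(1) by (intro Max_ge) auto
  finally show ?thesis by simp
qed

section \<open>Counting single crossing profiles\<close>

text \<open>Smaller keys are better. Permutations of \<open>C\<close> serve as keys for the constant
  profiles, \<open>swap_key\<close> for the swapped ones.\<close>

definition key_order :: "'c set \<Rightarrow> ('c \<Rightarrow> 'k::linorder) \<Rightarrow> ('c \<times> 'c) set" where
  "key_order C g = {(x, y). x \<in> C \<and> y \<in> C \<and> g x < g y}"

lemma key_order_preference:
  assumes "inj_on g C"
  shows "key_order C g \<in> preferences C"
  using assms unfolding key_order_def preferences_def strict_linear_order_on_def
  by (auto simp: trans_def irrefl_def total_on_def inj_on_def not_less_iff_gr_or_eq)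

text \<open>The number of candidates preferred to \<open>x\<close> is the rank of \<open>p x\<close>
  in \<open>C\<close>, and in a finite linear order the rank determines the element.\<close>

lemma key_order_inj:
  fixes p q :: "'c::linorder \<Rightarrow> 'c"
  assumes "finite C" "p permutes C" "q permutes C" "key_order C p = key_order C q"
  shows "p = q"
proof
  fix x
  have rank: "card {y. (y, x) \<in> key_order C s} = card {z \<in> C. z < s x}"
    if s: "s permutes C" and x: "x \<in> C" for s
  proof -
    have "s ` {y. (y, x) \<in> key_order C s} = {z \<in> C. z < s x}"
    proof (intro equalityI subsetI)
      fix z assume "z \<in> {z \<in> C. z < s x}"
      moreover from this obtain y where "y \<in> C" "z = s y"
        using permutes_image[OF s] by blast
      ultimately show "z \<in> s ` {y. (y, x) \<in> key_order C s}"
        using x by (auto simp: key_order_def)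
    qed (auto simp: key_order_def permutes_in_image[OF s])
    then show ?thesis
      using card_image[OF permutes_inj_on[OF s]] by metis
  qed
  show "p x = q x"
  proof (cases "x \<in> C")
    case True
    have mono: "card {z \<in> C. z < a} < card {z \<in> C. z < b}" if "a \<in> C" "a < b" for a b
      using assms(1) that by (intro psubset_card_mono) auto
    have "p x \<in> C" "q x \<in> C"
      using True assms(2,3) by (simp_all add: permutes_in_image)
    moreover have "card {z \<in> C. z < p x} = card {z \<in> C. z < q x}"
      using rank[OF assms(2) True] rank[OF assms(3) True] assms(4) by simp
    ultimately show ?thesis using mono[of "p x" "q x"] mono[of "q x" "p x"]
      by (cases "p x" "q x" rule: linorder_cases) simp_all
  next
    case False
    then show ?thesis using assms(2,3) by (simp add: permutes_not_in)
  qed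
qed

text \<open>A profile in which all voters agree is trivially single crossing, and voter 1 already
  reveals the permutation.\<close>

lemma fact_le_card_profiles:
  fixes C :: "'c::linorder set"
  assumes "finite C" "n \<ge> 1"
  shows "fact (card C) \<le> card (single_crossing_profiles C n id)"
proof -
  define F where "F p = (\<lambda>l\<in>{1..n}. key_order C p)" for p :: "'c \<Rightarrow> 'c"
  have "inj_on F {p. p permutes C}"
  proof (rule inj_onI)
    fix p q assume pq: "p \<in> {p. p permutes C}" "q \<in> {p. p permutes C}" "F p = F q"
    then have "F p 1 = F q 1" by simp
    then have "key_order C p = key_order C q" using assms(2) by (simp add: F_def)
    then show "p = q" using key_order_inj[OF assms(1)] pq(1,2) by blast
  qed
  moreover have "F ` {p. p permutes C} \<subseteq> single_crossing_profiles C n id"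
    by (auto simp: F_def single_crossing_profiles_def profiles_def single_crossing_def permutes_id
        intro!: key_order_preference permutes_inj_on)
  moreover have "finite (single_crossing_profiles C n id)"
    using finite_profiles[OF assms(1)] by (simp add: single_crossing_profiles_def)
  ultimately show ?thesis
    by (metis assms(1) card_inj_on_le card_permutations)
qed

text \<open>Sorting by \<open>swap_key r f l\<close> groups the candidates of ranks \<open>2i\<close> and \<open>2i + 1\<close> into block \<open>i\<close>,
  in their original order for the voters \<open>l \<le> f i\<close> and swapped for the voters \<open>l > f i\<close>. With an
  odd number of candidates the last block is a singleton, and its value of \<open>f\<close> is irrelevant.\<close>

definition swap_key :: "('c \<Rightarrow> nat) \<Rightarrow> (nat \<Rightarrow> nat) \<Rightarrow> nat \<Rightarrow> 'c \<Rightarrow> nat" where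
  "swap_key r f l x = 2 * (r x div 2) +
     (if f (r x div 2) < l then 1 - r x mod 2 else r x mod 2)"

lemma swap_key_div: "swap_key r f l x div 2 = r x div 2"
  by (simp add: swap_key_def)

lemma swap_key_inj:
  assumes "inj_on r C"
  shows "inj_on (swap_key r f l) C"
proof (rule inj_onI)
  fix x y assume xy: "x \<in> C" "y \<in> C" "swap_key r f l x = swap_key r f l y"
  then have d: "r x div 2 = r y div 2" by (metis swap_key_div)
  with xy(3) have "r x mod 2 = r y mod 2"
    by (auto simp: swap_key_def split: if_splits)
  with d have "r x = r y" by (metis div_mult_mod_eq)
  then show "x = y" using assms xy by (simp add: inj_on_eq_iff)
qed

text \<open>Makes single crossing visible: across blocks the order does not depend on
  \<open>l\<close>, and inside a block it changes at most once as \<open>l\<close> grows.\<close>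

lemma swap_key_less_iff:
  "swap_key r f l x < swap_key r f l y \<longleftrightarrow>
     r x div 2 < r y div 2 \<or>
     r x div 2 = r y div 2 \<and> (if f (r x div 2) < l then r y < r x else r x < r y)"
proof (cases "r x div 2 = r y div 2")
  case True
  then have "r x < r y \<longleftrightarrow> r x mod 2 < r y mod 2" "r y < r x \<longleftrightarrow> r y mod 2 < r x mod 2"
    using div_mult_mod_eq[of "r x" 2] div_mult_mod_eq[of "r y" 2] by linarith+
  then show ?thesis using True by (auto simp: swap_key_def)
next
  case False
  moreover have "a < b \<longleftrightarrow> a div 2 < b div 2" if "a div 2 \<noteq> b div 2" for a b :: nat
    using that by linarith
  ultimately show ?thesis by (simp add: swap_key_div)
qed

lemma power_le_card_profiles:
  fixes C :: "'c set"
  assumes C: "finite C"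
  shows "n ^ (card C div 2) \<le> card (single_crossing_profiles C n id)"
proof -
  let ?k = "card C div 2"
  obtain r where r: "bij_betw r C {0..<card C}"
    using ex_bij_betw_finite_nat[OF C] by blast
  then have r_inj: "inj_on r C" by (simp add: bij_betw_def)
  define F where "F f = (\<lambda>l\<in>{1..n}. key_order C (swap_key r f l))" for f
  \<comment> \<open>The value \<open>n\<close> leaves a block unswapped for all voters, so each
    block has \<open>n\<close> choices.\<close>
  let ?D = "{..<?k} \<rightarrow>\<^sub>E {1..n}"
  \<comment> \<open>Voter \<open>g i\<close> tells the profiles apart: block \<open>i\<close> is
    already swapped under \<open>f\<close> but not yet under \<open>g\<close>.\<close>
  have diff: "F f \<noteq> F g" if "i < ?k" "f i < g i" "g i \<in> {1..n}" for f g i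
  proof
    assume "F f = F g"
    then have "F f (g i) = F g (g i)" by simp
    then have eq: "key_order C (swap_key r f (g i)) = key_order C (swap_key r g (g i))"
      using that(3) by (simp add: F_def)
    have "2 * i \<in> r ` C" "2 * i + 1 \<in> r ` C"
      using r that(1) by (auto simp: bij_betw_def)
    then obtain x y where xy: "x \<in> C" "y \<in> C" "r x = 2 * i" "r y = 2 * i + 1"
      by (metis imageE)
    then have "(x, y) \<in> key_order C (swap_key r g (g i))"
      "(x, y) \<notin> key_order C (swap_key r f (g i))"
      using that(2) by (simp_all add: key_order_def swap_key_less_iff)
    with eq show False by simp
  qed
  have "inj_on F ?D"
  proof (rule inj_onI, rule ccontr)
    fix f g assume fg: "f \<in> ?D" "g \<in> ?D" "F f = F g" "f \<noteq> g"
    then obtain i where i: "i < ?k" "f i \<noteq> g i"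
      by (metis PiE_ext lessThan_iff)
    then have "f i \<in> {1..n}" "g i \<in> {1..n}" using fg(1,2) by (auto simp: PiE_def Pi_def)
    with i fg(3) diff[of i f g] diff[of i g f] show False
      by (metis linorder_neqE_nat)
  qed
  moreover have "F ` ?D \<subseteq> single_crossing_profiles C n id"
  proof clarify
    fix f
    have "F f \<in> profiles C n"
      using key_order_preference[OF swap_key_inj[OF r_inj]] by (simp add: F_def profiles_def)
    moreover have "single_crossing C n id (F f)"
      unfolding single_crossing_def
      by (auto simp: permutes_id F_def key_order_def swap_key_less_iff split: if_splits)
    ultimately show "F f \<in> single_crossing_profiles C n id"
      by (simp add: single_crossing_profiles_def)
  qed
  moreover have "finite (single_crossing_profiles C n id)"
    using finite_profiles[OF C] by (simp add: single_crossing_profiles_def)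
  ultimately have "card ?D \<le> card (single_crossing_profiles C n id)"
    by (rule card_inj_on_le)
  then show ?thesis by (simp add: card_PiE)
qed

section \<open>From the counts to the logarithmic bound\<close>

text \<open>Pairing the factor \<open>i\<close> of one factorial with \<open>m + 1 - i\<close> of
  the other gives \<open>m\<close> products, each at least \<open>m\<close>. This yields
  \<open>log (m!) >= (m/2) log m\<close> without Stirling's formula.\<close>

lemma power_self_le_fact_square: "m ^ m \<le> (fact m)\<^sup>2" for m :: nat
proof -
  have "m ^ m = (\<Prod>i=1..m. m)" by simp
  also have "\<dots> \<le> (\<Prod>i=1..m. i * (m + 1 - i))"
  proof (rule prod_mono)
    fix i assume "i \<in> {1..m}"
    then have "i = Suc (i - 1)" "m = Suc (i - 1 + (m - i))" by auto
    \<comment> \<open>The product becomes \<open>(a + 1) * (b + 1) = a * b + (a + b + 1)\<close>,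
      whose last summand is \<open>m\<close>.\<close>
    then obtain a b where "i = Suc a" "m = Suc (a + b)" by blast
    then show "0 \<le> m \<and> m \<le> i * (m + 1 - i)" by simp
  qed
  also have "\<dots> = (\<Prod>i=1..m. i) * (\<Prod>i=1..m. m + 1 - i)" by (rule prod.distrib)
  also have "(\<Prod>i=1..m. m + 1 - i) = (\<Prod>i=1..m. i)"
    using prod.atLeastAtMost_rev[of "\<lambda>i. i" 1 m] by simp
  finally show ?thesis by (simp add: fact_prod power2_eq_square)
qed

theorem theorem1:
  "\<exists>K::real. K > 0 \<and>
    (\<forall>(m::nat) (n::nat) (C::nat set) (A::nat procedure).
       m \<ge> 2 \<longrightarrow> n \<ge> 2 \<longrightarrow> finite C \<longrightarrow> card C = m \<longrightarrow>
       preference_elicitation C n (single_crossing_profiles C n id) A \<longrightarrow>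
       real (query_complexity (single_crossing_profiles C n id) A)
         \<ge> K * (real m * log 2 (real m) + real m * log 2 (real n)))"
proof (rule exI[of _ "1/6"], intro conjI allI impI)
  fix m n :: nat and C :: "nat set" and A :: "nat procedure"
  assume m: "m \<ge> 2" and n: "n \<ge> 2" and C: "finite C" "card C = m"
    and elic: "preference_elicitation C n (single_crossing_profiles C n id) A"
  let ?S = "single_crossing_profiles C n id"
  define Q where "Q = query_complexity ?S A"
  have "fact m \<le> card ?S" using fact_le_card_profiles[OF C(1), of n] C(2) n by simp
  moreover have "?S \<noteq> {}"
    using calculation by (metis card.empty fact_nonzero le_zero_eq)
  then have S: "card ?S \<le> 2 ^ Q"
    using card_le_query_complexity[OF elic _ C(1)]
    by (auto simp: single_crossing_profiles_def Q_def)
  ultimately have "(fact m)\<^sup>2 \<le> ((2::nat) ^ Q)\<^sup>2" by (intro power_mono) auto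
  then have "m ^ m \<le> 2 ^ (2 * Q)"
    using power_self_le_fact_square[of m] by (simp add: power_mult[symmetric] mult.commute)
  then have "real m ^ m \<le> 2 ^ (2 * Q)"
    by (metis of_nat_le_iff of_nat_numeral of_nat_power)
  then have "log 2 (real m ^ m) \<le> log 2 (2 ^ (2 * Q))" using m by (intro log_mono) auto
  then have 1: "real m * log 2 (real m) \<le> 2 * Q" using m by (simp add: log_nat_power)
  have "n ^ (m div 2) \<le> 2 ^ Q"
    using power_le_card_profiles[OF C(1), of n] C(2) S by simp
  then have "real n ^ (m div 2) \<le> 2 ^ Q"
    by (metis of_nat_le_iff of_nat_numeral of_nat_power)
  then have "log 2 (real n ^ (m div 2)) \<le> log 2 (2 ^ Q)" using n by (intro log_mono) auto
  then have 2: "real (m div 2) * log 2 (real n) \<le> Q" using n by (simp add: log_nat_power)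
  \<comment> \<open>Rounding down in \<open>m div 2\<close> costs most at \<open>m = 3\<close>,
    where equality holds.\<close>
  have "m \<le> 3 * (m div 2)" using m by linarith
  then have "real m \<le> 3 * real (m div 2)" by linarith
  moreover have "log 2 (real n) \<ge> 0" using n by simp
  ultimately have "real m * log 2 (real n) \<le> 3 * real (m div 2) * log 2 (real n)"
    by (rule mult_right_mono)
  \<comment> \<open>The bounds \<open>2 * Q\<close> for \<open>m log m\<close> and
    \<open>3 * Q\<close> for \<open>m log n\<close> add up to \<open>5 * Q\<close>, within the
    \<open>6 * Q\<close> allowed by the constant \<open>1/6\<close>.\<close>
  with 1 2 show "1 / 6 * (real m * log 2 (real m) + real m * log 2 (real n))
      \<le> real (query_complexity ?S A)"
    by (simp add: Q_def)
qed simp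

end
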